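(* Let $H$ be a group and $S = \{1_S, c\}$ a set with two elements. Then: (1) There exists a bijection between the set $\mathcal{GES}(H,(S,1_S))$ of all group extending structures of $H$ and $\mathcal{T}(H)$. The bijection is such that the group extending structure $\bigl((S,1_S,\ast),\triangleleft,\triangleright,f\bigr)$ corresponding to $(h_0,D)\in\mathcal{T}(H)$ is defined as follows: $\triangleleft$ is the trivial action of $H$ on $S$ (i.e. $s \triangleleft h = s$ for all $s \in S$, $h \in H$), $\ast$ is given by $c\ast c = 1_S$, and $\triangleright : S\times H\to H$ and $f : S\times S\to H$ are given for any $h\in H$ by $$c\triangleright h := D(h),\qquad f(c,c) := h_0$$ (the remaining values being determined by the normalizing conditions). (2) There exists a bijection $\mathcal{K}^2_\ltimes(H,(S,1_S))\cong\mathcal{T}(H)/\sim$, where $\sim$ is the equivalence relation on $\mathcal{T}(H)$ defined as follows: $(h_0,D)\sim(h_0',D')$ if and only if there exists $g\in H$ such that for any $h\in H$ $$h_0 = g\,D'(g)\,h_0',\qquad D(h) = g\,D'(h)\,g^{-1}.$$ The bijection between $\mathcal{T}(H)/\sim$ and the isomorphism classes, under isomorphisms that stabilize $H$, of all groups that contain $H$ as a subgroup of index $2$ is given by $$\overline{(h_0,D)}\mapsto H\ltimes_{(h_0,D)}S,$$ where $H\ltimes_{(h_0,D)}S$ is the unified product associated to the group extending structure corresponding to $(h_0,D)$ in (1) and $\overline{(h_0,D)}$ is the equivalence class of $(h_0,D)$ under $\sim$. Explicitly, the multiplication on the group $H\ltimes_{(h_0,D)}S$ is given for any $h,h_1,h_2\in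 H$ by $$(h_1,1_S)\cdot(h_2,1_S) = (h_1h_2,1_S),\qquad (1,c)\cdot(1,c) = (h_0,1_S),$$ $$(h,1_S)\cdot(1,c) = (h,c),\qquad (1,c)\cdot(h,1_S) = (D(h),c).$$
   Context: For a group $H$, $\mathcal{T}(H)\subseteq H\times\mathrm{Aut}(H)$ denotes the set of all pairs $(h_0,D)$ where $h_0\in H$ and $D$ is an automorphism of $H$ such that $D(h_0) = h_0$ and $D^2(h) = h_0hh_0^{-1}$ for all $h\in H$. Let $H$ be a group with unit $1_H$. An extending datum of $H$ is a system $\Omega(H) = \bigl((S,1_S,\ast),\triangleleft,\triangleright,f\bigr)$ where $(S,1_S)$ is a pointed set (a nonempty set $S$ with a fixed element $1_S\in S$), and $\ast : S\times S\to S$, $\triangleleft : S\times H\to S$, $\triangleright : S\times H\to H$, $f : S\times S\to H$ are maps satisfying the normalizing conditions, for all $s\in S$, $h\in H$: $s\ast 1_S = 1_S\ast s = s$, $s\triangleleft 1_H = s$, $1_S\triangleleft h = 1_S$, $1_S\triangleright h = h$, $s\triangleright 1_H = 1_H$, $f(s,1_S) = f(1_S,s) = 1_H$. For an extending datum $\Omega(H)$, $H\ltimes_\Omega S$ denotes the set $H\times S$ with the binary operation $$(h_1,s_1)\cdot(h_2,s_2) := \bigl(h_1(s_1\triangleright h_2)f(s_1\triangleleft h_2,s_2),\ (s_1\triangleleft h_2)\ast s_2\bigr).$$ $\Omega(H)$ is called a group extending structure of $H$ if $H\ltimes_\Omega S$ is a group with this multiplication; $H\ltimes_\Omega S$ is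 then called the unified product. $H$ is regarded as a subgroup of it via $h\mapsto(h,1_S)$. $\mathcal{GES}(H,(S,1_S))$ denotes the set of all quadruples $(\ast,\triangleleft,\triangleright,f)$ such that $\bigl((S,1_S,\ast),\triangleleft,\triangleright,f\bigr)$ is a group extending structure of $H$. Two elements $(\ast,\triangleleft,\triangleright,f)$ and $(\ast',\triangleleft',\triangleright',f')$ of this set are called equivalent if there exist maps $r : S\to H$ and $v : S\to S$ with $r(1_S) = 1_H$, $v(1_S) = 1_S$, $v$ bijective, such that for all $s,s_1,s_2\in S$, $h\in H$: $$v(s\triangleleft h) = v(s)\triangleleft' h,\qquad (s\triangleright h)\,r(s\triangleleft h) = r(s)\,\bigl(v(s)\triangleright' h\bigr),$$ $$v(s_1\ast s_2) = \bigl(v(s_1)\triangleleft' r(s_2)\bigr)\ast' v(s_2),$$ $$f(s_1,s_2)\,r(s_1\ast s_2) = r(s_1)\,\bigl(v(s_1)\triangleright' r(s_2)\bigr)\,f'\bigl(v(s_1)\triangleleft' r(s_2),\,v(s_2)\bigr).$$ This is an equivalence relation and $\mathcal{K}^2_\ltimes(H,(S,1_S))$ denotes the quotient set. An isomorphism of groups $\psi : E\to E'$ between two groups containing $H$ as a subgroup stabilizes $H$ if $\psi(h) = h$ for all $h\in H$. *)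

theory Defs
  imports "HOL-Algebra.Coset" "HOL-Algebra.Bij"
begin

text \<open>All maps on a product set are taken to be extensional (equal to \<open>undefined\<close> off their
  domain), so that two of them are equal as HOL functions iff they agree on the domain. The set
  \<open>auto H\<close> of the library is extensional for the same reason.\<close>

definition auto_pairs :: "('h, 'm) monoid_scheme \<Rightarrow> ('h \<times> ('h \<Rightarrow> 'h)) set"
  where "auto_pairs H = {(h0, D). h0 \<in> carrier H \<and> D \<in> auto H \<and> D h0 = h0 \<and>
    (\<forall>h\<in>carrier H. D (D h) = h0 \<otimes>\<^bsub>H\<^esub> h \<otimes>\<^bsub>H\<^esub> inv\<^bsub>H\<^esub> h0)}"

text \<open>The quadruple \<open>(ast, tl, tr, f)\<close> stands for \<open>(\<ast>, \<triangleleft>, \<triangleright>, f)\<close>; the pointed set is \<open>(S, e)\<close>.\<close>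

type_synonym ('h, 's) ext_quad =
  "('s \<times> 's \<Rightarrow> 's) \<times> ('s \<times> 'h \<Rightarrow> 's) \<times> ('s \<times> 'h \<Rightarrow> 'h) \<times> ('s \<times> 's \<Rightarrow> 'h)"

definition extending_datum ::
    "('h, 'm) monoid_scheme \<Rightarrow> 's set \<Rightarrow> 's \<Rightarrow> ('h, 's) ext_quad \<Rightarrow> bool"
  where "extending_datum H S e = (\<lambda>(ast, tl, tr, f).
    e \<in> S \<and>
    ast \<in> S \<times> S \<rightarrow>\<^sub>E S \<and>
    tl \<in> S \<times> carrier H \<rightarrow>\<^sub>E S \<and>
    tr \<in> S \<times> carrier H \<rightarrow>\<^sub>E carrier H \<and>
    f \<in> S \<times> S \<rightarrow>\<^sub>E carrier H \<and>
    (\<forall>s\<in>S. ast (s, e) = s \<and> ast (e, s) = s) \<and>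
    (\<forall>s\<in>S. tl (s, \<one>\<^bsub>H\<^esub>) = s) \<and>
    (\<forall>h\<in>carrier H. tl (e, h) = e) \<and>
    (\<forall>h\<in>carrier H. tr (e, h) = h) \<and>
    (\<forall>s\<in>S. tr (s, \<one>\<^bsub>H\<^esub>) = \<one>\<^bsub>H\<^esub>) \<and>
    (\<forall>s\<in>S. f (s, e) = \<one>\<^bsub>H\<^esub> \<and> f (e, s) = \<one>\<^bsub>H\<^esub>))"

text \<open>The unit is \<open>(1\<^sub>H, e)\<close>: by the normalizing conditions it is a left identity, so it is the only
  possible unit for which this multiplication is a group.\<close>

definition unified_product ::
    "('h, 'm) monoid_scheme \<Rightarrow> 's set \<Rightarrow> 's \<Rightarrow> ('h, 's) ext_quad \<Rightarrow> ('h \<times> 's) monoid"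
  where "unified_product H S e = (\<lambda>(ast, tl, tr, f).
    \<lparr>carrier = carrier H \<times> S,
     mult = (\<lambda>(h1, s1) (h2, s2).
       (h1 \<otimes>\<^bsub>H\<^esub> tr (s1, h2) \<otimes>\<^bsub>H\<^esub> f (tl (s1, h2), s2), ast (tl (s1, h2), s2))),
     one = (\<one>\<^bsub>H\<^esub>, e)\<rparr>)"

definition GES :: "('h, 'm) monoid_scheme \<Rightarrow> 's set \<Rightarrow> 's \<Rightarrow> ('h, 's) ext_quad set"
  where "GES H S e = {\<Omega>. extending_datum H S e \<Omega> \<and> group (unified_product H S e \<Omega>)}"

definition GES_rel :: "('h, 'm) monoid_scheme \<Rightarrow> 's set \<Rightarrow> 's \<Rightarrow> ('h, 's) ext_quad rel"
  where "GES_rel H S e = {((ast, tl, tr, f), (ast', tl', tr', f')).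
    (ast, tl, tr, f) \<in> GES H S e \<and> (ast', tl', tr', f') \<in> GES H S e \<and>
    (\<exists>r v. r \<in> S \<rightarrow> carrier H \<and> bij_betw v S S \<and> r e = \<one>\<^bsub>H\<^esub> \<and> v e = e \<and>
      (\<forall>s\<in>S. \<forall>h\<in>carrier H.
        v (tl (s, h)) = tl' (v s, h) \<and>
        tr (s, h) \<otimes>\<^bsub>H\<^esub> r (tl (s, h)) = r s \<otimes>\<^bsub>H\<^esub> tr' (v s, h)) \<and>
      (\<forall>s1\<in>S. \<forall>s2\<in>S.
        v (ast (s1, s2)) = ast' (tl' (v s1, r s2), v s2) \<and>
        f (s1, s2) \<otimes>\<^bsub>H\<^esub> r (ast (s1, s2)) =
          r s1 \<otimes>\<^bsub>H\<^esub> tr' (v s1, r s2) \<otimes>\<^bsub>H\<^esub> f' (tl' (v s1, r s2), v s2)))}"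

definition K2 :: "('h, 'm) monoid_scheme \<Rightarrow> 's set \<Rightarrow> 's \<Rightarrow> ('h, 's) ext_quad set set"
  where "K2 H S e = GES H S e // GES_rel H S e"

text \<open>For \<open>S = {e, c}\<close>: the quadruple with trivial \<open>\<triangleleft>\<close>, \<open>c \<ast> c = e\<close>, \<open>c \<triangleright> h = D h\<close> and
  \<open>f (c, c) = h0\<close>; the other values are those forced by the normalizing conditions.\<close>

definition quad_of_pair ::
    "('h, 'm) monoid_scheme \<Rightarrow> 's \<Rightarrow> 's \<Rightarrow> 'h \<times> ('h \<Rightarrow> 'h) \<Rightarrow> ('h, 's) ext_quad"
  where "quad_of_pair H e c = (\<lambda>(h0, D).
    (\<lambda>(s, t)\<in>{e, c} \<times> {e, c}. if s = e then t else if t = e then s else e,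
     \<lambda>(s, h)\<in>{e, c} \<times> carrier H. s,
     \<lambda>(s, h)\<in>{e, c} \<times> carrier H. if s = c then D h else h,
     \<lambda>(s, t)\<in>{e, c} \<times> {e, c}. if s = c \<and> t = c then h0 else \<one>\<^bsub>H\<^esub>))"

definition pair_rel :: "('h, 'm) monoid_scheme \<Rightarrow> ('h \<times> ('h \<Rightarrow> 'h)) rel"
  where "pair_rel H = {((h0, D), (h0', D')).
    (h0, D) \<in> auto_pairs H \<and> (h0', D') \<in> auto_pairs H \<and>
    (\<exists>g\<in>carrier H. h0 = g \<otimes>\<^bsub>H\<^esub> D' g \<otimes>\<^bsub>H\<^esub> h0' \<and>
      (\<forall>h\<in>carrier H. D h = g \<otimes>\<^bsub>H\<^esub> D' h \<otimes>\<^bsub>H\<^esub> inv\<^bsub>H\<^esub> g))}"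

text \<open>A group containing \<open>H\<close> as a subgroup is a group \<open>E\<close> together with an injective homomorphism
  \<open>i\<close> from \<open>H\<close> to \<open>E\<close>. For an actual subgroup \<open>i\<close> is the inclusion; for a unified product it is
  \<open>h \<mapsto> (h, e)\<close>.\<close>

definition index2_overgroups :: "('h, 'm) monoid_scheme \<Rightarrow> ('e monoid \<times> ('h \<Rightarrow> 'e)) set"
  where "index2_overgroups H = {(E, i). group E \<and> i \<in> hom H E \<and> inj_on i (carrier H) \<and>
    card (rcosets\<^bsub>E\<^esub> (i ` carrier H)) = 2}"

definition iso_stabilizing :: "('h, 'm) monoid_scheme \<Rightarrow>
    'e monoid \<times> ('h \<Rightarrow> 'e) \<Rightarrow> 'f monoid \<times> ('h \<Rightarrow> 'f) \<Rightarrow> bool"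
  where "iso_stabilizing H = (\<lambda>(E, i) (E', i').
    \<exists>\<psi>\<in>iso E E'. \<forall>h\<in>carrier H. \<psi> (i h) = i' h)"

definition overgroup_rel :: "('h, 'm) monoid_scheme \<Rightarrow> ('e monoid \<times> ('h \<Rightarrow> 'e)) rel"
  where "overgroup_rel H = {(X, Y). X \<in> index2_overgroups H \<and> Y \<in> index2_overgroups H \<and>
    iso_stabilizing H X Y}"

definition pair_overgroup :: "('h, 'm) monoid_scheme \<Rightarrow> 's \<Rightarrow> 's \<Rightarrow> 'h \<times> ('h \<Rightarrow> 'h) \<Rightarrow>
    ('h \<times> 's) monoid \<times> ('h \<Rightarrow> 'h \<times> 's)"
  where "pair_overgroup H e c p =
    (unified_product H {e, c} e (quad_of_pair H e c p), \<lambda>h. (h, e))"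

end

theory Submission
  imports Defs
begin

text \<open>
  A group \<open>E\<close> that contains \<open>H\<close> with index 2 is \<open>H \<union> H x\<close> for any \<open>x\<close> outside \<open>H\<close>. Such an \<open>x\<close>
  normalizes \<open>H\<close> and has its square in \<open>H\<close>, so it yields the pair of \<open>h0 = x\<^sup>2\<close> and the
  automorphism \<open>D h = x h x\<^sup>-\<^sup>1\<close>. The conditions that define \<open>auto_pairs\<close> say that \<open>x\<close> commutes
  with \<open>x\<^sup>2\<close> and that conjugating twice by \<open>x\<close> is conjugating by \<open>x\<^sup>2\<close>
  (\<open>auto_pairs_if_realizes\<close>, \<open>realizes_ex\<close>). Conversely these conditions make the
  multiplication built from \<open>(h0, D)\<close> associative (\<open>pair_product_group\<close>).

  The classification of overgroups follows from one equivalence, \<open>iso_stabilizing_iff_realizes\<close>: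
  the group built from \<open>(h0, D)\<close> is isomorphic to \<open>E\<close> over \<open>H\<close> iff some \<open>x\<close> outside \<open>H\<close> in \<open>E\<close>
  yields \<open>(h0, D)\<close>. As every such \<open>x\<close> yields some pair, every \<open>E\<close> arises. Applied to the group built from another pair \<open>(h0', D')\<close>, where the elements outside
  \<open>H\<close> are the \<open>(g, c)\<close>, it turns into the formula for \<open>\<sim>\<close> (\<open>iso_stabilizing_iff_pair_rel\<close>). Hence
  \<open>\<sim>\<close> is an equivalence relation, and its classes correspond to the isomorphism classes.

  The bijection with group extending structures comes from the same source: the pair realized by
  \<open>x = (1, c)\<close> in the unified product of a structure determines its four maps
  (\<open>bij_betw_quad_of_pair\<close>). Finally, in an equivalence \<open>(r, v)\<close> of two structures \<open>v\<close> must be the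
  identity, and the conditions on \<open>g = r c\<close> are again the formula for \<open>\<sim>\<close>
  (\<open>GES_rel_iff_pair_rel\<close>).
\<close>

section \<open>Quotients by compatible equivalence relations\<close>

lemma equiv_pullback:
  assumes "equiv B Q" and "F \<in> A \<rightarrow> B" and "R \<subseteq> A \<times> A"
    and iff: "\<And>x y. x \<in> A \<Longrightarrow> y \<in> A \<Longrightarrow> (x, y) \<in> R \<longleftrightarrow> (F x, F y) \<in> Q"
  shows "equiv A R"
proof (rule equivI)
  show "R \<subseteq> A \<times> A" by fact
  show "refl_on A R"
    using assms by (auto simp: refl_on_def equiv_def Pi_iff)
  have "sym Q" "trans Q" using assms(1) by (simp_all add: equiv_def)
  show "sym R"
    using iff assms(3) symD[OF \<open>sym Q\<close>] by (intro symI) blast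
  show "trans R"
  proof (rule transI)
    fix x y z assume xyz: "(x, y) \<in> R" "(y, z) \<in> R"
    then have A: "x \<in> A" "y \<in> A" "z \<in> A" using assms(3) by auto
    then have "(F x, F z) \<in> Q" using xyz iff transD[OF \<open>trans Q\<close>, of "F x" "F y"] by simp
    then show "(x, z) \<in> R" using A iff by simp
  qed
qed

lemma bij_betw_quotients:
  assumes R: "equiv A R" and Q: "equiv B Q" and F: "F \<in> A \<rightarrow> B"
    and iff: "\<And>x y. x \<in> A \<Longrightarrow> y \<in> A \<Longrightarrow> (x, y) \<in> R \<longleftrightarrow> (F x, F y) \<in> Q"
    and onto: "\<And>b. b \<in> B \<Longrightarrow> \<exists>a\<in>A. (F a, b) \<in> Q"
  shows "\<exists>\<Phi>. bij_betw \<Phi> (A // R) (B // Q) \<and> (\<forall>a\<in>A. \<Phi> (R `` {a}) = Q `` {F a})"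
proof -
  define \<Phi> where "\<Phi> K = Q `` {F (SOME a. a \<in> K)}" for K
  have \<Phi>: "\<Phi> (R `` {a}) = Q `` {F a}" if "a \<in> A" for a
  proof -
    have "a \<in> R `` {a}" using R that by (rule equiv_class_self)
    then have "(SOME b. b \<in> R `` {a}) \<in> R `` {a}" by (rule someI)
    then have "(a, SOME b. b \<in> R `` {a}) \<in> R" by simp
    moreover from this have "(SOME b. b \<in> R `` {a}) \<in> A"
      using equiv_type[OF R] by blast
    ultimately have "(F a, F (SOME b. b \<in> R `` {a})) \<in> Q"
      using iff that by blast
    then show ?thesis unfolding \<Phi>_def by (simp add: equiv_class_eq[OF Q])
  qed
  have "inj_on \<Phi> (A // R)"
  proof (rule inj_onI)
    fix K L assume "K \<in> A // R" "L \<in> A // R" and eq: "\<Phi> K = \<Phi> L"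
    then obtain a b where ab: "a \<in> A" "K = R `` {a}" "b \<in> A" "L = R `` {b}"
      by (auto elim!: quotientE)
    then have "(F a, F b) \<in> Q"
      using eq \<Phi> F Q by (metis Pi_iff eq_equiv_class)
    then show "K = L" using ab iff R by (metis equiv_class_eq)
  qed
  moreover have "\<Phi> ` (A // R) = B // Q"
  proof (intro equalityI subsetI)
    fix L assume "L \<in> \<Phi> ` (A // R)"
    then show "L \<in> B // Q" using \<Phi> F by (auto elim!: quotientE intro!: quotientI)
  next
    fix L assume "L \<in> B // Q"
    then obtain b where b: "b \<in> B" "L = Q `` {b}" by (auto elim!: quotientE)
    with onto obtain a where a: "a \<in> A" "(F a, b) \<in> Q" by blast
    then have "L = \<Phi> (R `` {a})" using b \<Phi> Q by (metis equiv_class_eq)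
    then show "L \<in> \<Phi> ` (A // R)" using a by (auto intro: quotientI)
  qed
  ultimately show ?thesis using \<Phi> unfolding bij_betw_def by blast
qed


section \<open>Subgroups of index two\<close>

lemma (in group) card_rcosets_eq_2_iff:
  assumes K: "subgroup K G" and x: "x \<in> carrier G - K"
  shows "card (rcosets K) = 2 \<longleftrightarrow> carrier G = K \<union> (K #> x)"
proof -
  have KG: "K \<subseteq> carrier G" using K by (rule subgroup.subset)
  have K1: "K #> \<one> = K" using KG by (rule coset_mult_one)
  have in_rc: "K \<in> rcosets K" "K #> x \<in> rcosets K"
    using K1 rcosetsI[OF KG] x by (metis one_closed, blast)
  have ne: "K \<noteq> K #> x" using x rcos_self[OF _ K] by blast
  show ?thesis
  proof
    assume "card (rcosets K) = 2"
    then have "rcosets K = {K, K #> x}"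
      using in_rc ne by (metis card_2_iff doubleton_eq_iff insert_iff singletonD)
    then have "\<Union> {K, K #> x} = carrier G" using rcosets_part_G[OF K] by (rule subst)
    then show "carrier G = K \<union> (K #> x)" by blast
  next
    assume c: "carrier G = K \<union> (K #> x)"
    have cos: "K #> y \<in> {K, K #> x}" if y: "y \<in> carrier G" for y
    proof -
      consider "y \<in> K" | "y \<in> K #> x" using y unfolding c by blast
      then show ?thesis
      proof cases
        case 1
        then show ?thesis using coset_join2[OF y K] by simp
      next
        case 2
        then show ?thesis using repr_independence[OF 2 _ K] x by simp
      qed
    qed
    have "rcosets K \<subseteq> {K, K #> x}" unfolding RCOSETS_def using cos by blast
    then have "rcosets K = {K, K #> x}" using in_rc by blast
    then show "card (rcosets K) = 2" using ne by simp
  qed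
qed

lemma (in group) ex_notin_if_card_rcosets_eq_2:
  assumes "subgroup K G" and "card (rcosets K) = 2"
  shows "\<exists>x. x \<in> carrier G - K"
proof (rule ccontr)
  assume "\<nexists>x. x \<in> carrier G - K"
  then have "rcosets K \<subseteq> {K}" using assms(1) coset_join2 by (auto simp: RCOSETS_def)
  then have "card (rcosets K) \<le> card {K}" by (intro card_mono) auto
  with assms(2) show False by simp
qed

lemma index2_overgroupsD:
  assumes "group H" and "(E, i) \<in> index2_overgroups H"
  shows "group E" and "i \<in> hom H E" and "inj_on i (carrier H)"
    and "subgroup (i ` carrier H) E" and "card (rcosets\<^bsub>E\<^esub> (i ` carrier H)) = 2"
proof -
  show *: "group E" "i \<in> hom H E" "inj_on i (carrier H)"
      "card (rcosets\<^bsub>E\<^esub> (i ` carrier H)) = 2"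
    using assms(2) by (auto simp: index2_overgroups_def)
  show "subgroup (i ` carrier H) E"
    using assms(1) * by (intro group_hom.img_is_subgroup) (simp add: group_hom_def group_hom_axioms_def)
qed

lemma index2_overgroup_cases:
  assumes "group H" and "(E, i) \<in> index2_overgroups H"
    and "x \<in> carrier E - i ` carrier H" and "y \<in> carrier E"
  obtains h where "h \<in> carrier H" "y = i h" | h where "h \<in> carrier H" "y = i h \<otimes>\<^bsub>E\<^esub> x"
proof -
  note E = index2_overgroupsD[OF assms(1,2)]
  have "carrier E = i ` carrier H \<union> (i ` carrier H #>\<^bsub>E\<^esub> x)"
    using group.card_rcosets_eq_2_iff[OF E(1) E(4) assms(3)] E(5) by blast
  with assms(4) have "y \<in> i ` carrier H \<or> y \<in> i ` carrier H #>\<^bsub>E\<^esub> x" by blast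
  then show thesis using that unfolding r_coset_def by blast
qed

text \<open>The two cosets are disjoint: otherwise \<open>x\<close> would be a quotient of two elements of the
  subgroup.\<close>

lemma coset_disjoint:
  assumes "group H" "group E" "i \<in> hom H E" "x \<in> carrier E - i ` carrier H"
    and "h \<in> carrier H" "k \<in> carrier H"
  shows "i h \<otimes>\<^bsub>E\<^esub> x \<noteq> i k" and "x \<otimes>\<^bsub>E\<^esub> i h \<noteq> i k"
proof -
  interpret H: group H by fact
  interpret E: group E by fact
  interpret i: group_hom H E i using assms by unfold_locales
  show "i h \<otimes>\<^bsub>E\<^esub> x \<noteq> i k"
  proof
    assume "i h \<otimes>\<^bsub>E\<^esub> x = i k"
    then have "x = i (inv\<^bsub>H\<^esub> h \<otimes>\<^bsub>H\<^esub> k)"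
      using assms(4-6) by (metis (no_types) DiffD1 E.inv_solve_left' H.inv_closed i.hom_closed i.hom_inv i.hom_mult)
    moreover have "inv\<^bsub>H\<^esub> h \<otimes>\<^bsub>H\<^esub> k \<in> carrier H" using assms(5,6) by simp
    ultimately show False using assms(4) by blast
  qed
  show "x \<otimes>\<^bsub>E\<^esub> i h \<noteq> i k"
  proof
    assume "x \<otimes>\<^bsub>E\<^esub> i h = i k"
    then have "x = i (k \<otimes>\<^bsub>H\<^esub> inv\<^bsub>H\<^esub> h)"
      using assms(4-6) by (metis (no_types) DiffD1 E.inv_solve_right' H.inv_closed i.hom_closed i.hom_inv i.hom_mult)
    moreover have "k \<otimes>\<^bsub>H\<^esub> inv\<^bsub>H\<^esub> h \<in> carrier H" using assms(5,6) by simp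
    ultimately show False using assms(4) by blast
  qed
qed


section \<open>Pairs realized by elements of an overgroup\<close>

text \<open>The condition on \<open>D\<close> is \<open>D h = x h x\<^sup>-\<^sup>1\<close>, written without inverses.\<close>

definition realizes ::
    "('h, 'm) monoid_scheme \<Rightarrow> 'e monoid \<Rightarrow> ('h \<Rightarrow> 'e) \<Rightarrow> 'e \<Rightarrow> 'h \<times> ('h \<Rightarrow> 'h) \<Rightarrow> bool"
  where "realizes H E i x = (\<lambda>(h0, D). x \<in> carrier E - i ` carrier H \<and> x \<otimes>\<^bsub>E\<^esub> x = i h0 \<and>
    (\<forall>h\<in>carrier H. x \<otimes>\<^bsub>E\<^esub> i h = i (D h) \<otimes>\<^bsub>E\<^esub> x))"

lemma auto_pairsD:
  assumes "group H" and "(h0, D) \<in> auto_pairs H"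
  shows "h0 \<in> carrier H" and "\<And>h. h \<in> carrier H \<Longrightarrow> D h \<in> carrier H"
    and "\<And>h k. h \<in> carrier H \<Longrightarrow> k \<in> carrier H \<Longrightarrow> D (h \<otimes>\<^bsub>H\<^esub> k) = D h \<otimes>\<^bsub>H\<^esub> D k"
    and "D \<one>\<^bsub>H\<^esub> = \<one>\<^bsub>H\<^esub>" and "D h0 = h0" and "D \<in> extensional (carrier H)"
    and "\<And>h. h \<in> carrier H \<Longrightarrow> D (D h) \<otimes>\<^bsub>H\<^esub> h0 = h0 \<otimes>\<^bsub>H\<^esub> h"
proof -
  interpret H: group H by fact
  have D: "D \<in> hom H H" "D \<in> extensional (carrier H)" and h0: "h0 \<in> carrier H"
    and sq: "\<And>h. h \<in> carrier H \<Longrightarrow> D (D h) = h0 \<otimes>\<^bsub>H\<^esub> h \<otimes>\<^bsub>H\<^esub> inv\<^bsub>H\<^esub> h0"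
    using assms(2) by (auto simp: auto_pairs_def auto_def Bij_def)
  show "h0 \<in> carrier H" "D h0 = h0" "D \<in> extensional (carrier H)"
    using assms(2) D by (auto simp: auto_pairs_def)
  show "D \<one>\<^bsub>H\<^esub> = \<one>\<^bsub>H\<^esub>" using D(1) by (rule hom_one) fact+
  show "D h \<in> carrier H" if "h \<in> carrier H" for h using D(1) that by (auto simp: hom_def)
  show "D (h \<otimes>\<^bsub>H\<^esub> k) = D h \<otimes>\<^bsub>H\<^esub> D k" if "h \<in> carrier H" "k \<in> carrier H" for h k
    using D(1) that by (auto simp: hom_def)
  show "D (D h) \<otimes>\<^bsub>H\<^esub> h0 = h0 \<otimes>\<^bsub>H\<^esub> h" if "h \<in> carrier H" for h
    using sq[OF that] h0 that by (simp add: H.m_assoc)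
qed

text \<open>Each identity for \<open>(h0, D)\<close> is proved by multiplying it by \<open>x\<close> inside \<open>E\<close>, where \<open>D\<close> becomes
  conjugation. Bijectivity of \<open>D\<close> comes for free, because \<open>D \<circ> D\<close> is an inner automorphism.\<close>

lemma auto_pairs_if_realizes:
  assumes "group H" "group E" "i \<in> hom H E" "inj_on i (carrier H)"
    and h0: "h0 \<in> carrier H" and D: "D \<in> carrier H \<rightarrow>\<^sub>E carrier H"
    and x: "realizes H E i x (h0, D)"
  shows "(h0, D) \<in> auto_pairs H"
proof -
  interpret H: group H by fact
  interpret E: group E by fact
  interpret i: group_hom H E i using assms by unfold_locales
  have xE: "x \<in> carrier E" and xx: "x \<otimes>\<^bsub>E\<^esub> x = i h0"
    and xi: "\<And>h. h \<in> carrier H \<Longrightarrow> x \<otimes>\<^bsub>E\<^esub> i h = i (D h) \<otimes>\<^bsub>E\<^esub> x"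
    using x by (auto simp: realizes_def)
  have DH: "D h \<in> carrier H" if "h \<in> carrier H" for h using D that by auto
  have cancel: "h = k" if "h \<in> carrier H" "k \<in> carrier H" "i h \<otimes>\<^bsub>E\<^esub> x = i k \<otimes>\<^bsub>E\<^esub> x" for h k
    using that xE assms(4) by (simp add: inj_onD)
  have mult: "D (h \<otimes>\<^bsub>H\<^esub> k) = D h \<otimes>\<^bsub>H\<^esub> D k" if hk: "h \<in> carrier H" "k \<in> carrier H" for h k
  proof (rule cancel)
    have "i (D (h \<otimes>\<^bsub>H\<^esub> k)) \<otimes>\<^bsub>E\<^esub> x = x \<otimes>\<^bsub>E\<^esub> i h \<otimes>\<^bsub>E\<^esub> i k"
      using hk xE by (simp add: xi[symmetric] E.m_assoc)
    also have "\<dots> = i (D h) \<otimes>\<^bsub>E\<^esub> (x \<otimes>\<^bsub>E\<^esub> i k)" using hk xE DH by (simp add: xi[OF hk(1)] E.m_assoc)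
    also have "\<dots> = i (D h \<otimes>\<^bsub>H\<^esub> D k) \<otimes>\<^bsub>E\<^esub> x" using hk xE DH by (simp add: xi E.m_assoc)
    finally show "i (D (h \<otimes>\<^bsub>H\<^esub> k)) \<otimes>\<^bsub>E\<^esub> x = i (D h \<otimes>\<^bsub>H\<^esub> D k) \<otimes>\<^bsub>E\<^esub> x" .
  qed (use hk DH in auto)
  have Dh0: "D h0 = h0"
  proof (rule cancel)
    show "i (D h0) \<otimes>\<^bsub>E\<^esub> x = i h0 \<otimes>\<^bsub>E\<^esub> x"
      using h0 xE by (simp add: xi[symmetric] xx[symmetric] E.m_assoc)
  qed (use h0 DH in auto)
  have sq: "D (D h) = h0 \<otimes>\<^bsub>H\<^esub> h \<otimes>\<^bsub>H\<^esub> inv\<^bsub>H\<^esub> h0" if h: "h \<in> carrier H" for h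
  proof -
    have "i (D (D h) \<otimes>\<^bsub>H\<^esub> h0) = i (D (D h)) \<otimes>\<^bsub>E\<^esub> x \<otimes>\<^bsub>E\<^esub> x"
      using h h0 xE DH by (simp add: xx E.m_assoc)
    also have "\<dots> = x \<otimes>\<^bsub>E\<^esub> (i (D h) \<otimes>\<^bsub>E\<^esub> x)" using h xE DH by (simp add: xi[symmetric] E.m_assoc)
    also have "\<dots> = x \<otimes>\<^bsub>E\<^esub> x \<otimes>\<^bsub>E\<^esub> i h" using h xE by (simp add: xi[symmetric] E.m_assoc)
    also have "\<dots> = i (h0 \<otimes>\<^bsub>H\<^esub> h)" using h h0 by (simp add: xx)
    finally have "D (D h) \<otimes>\<^bsub>H\<^esub> h0 = h0 \<otimes>\<^bsub>H\<^esub> h"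
      using assms(4) h h0 DH by (simp add: inj_on_eq_iff del: i.hom_mult)
    then show ?thesis using h h0 DH by (simp add: H.inv_solve_right)
  qed
  have "inj_on D (carrier H)"
  proof (rule inj_onI)
    fix h k assume hk: "h \<in> carrier H" "k \<in> carrier H" "D h = D k"
    then have "h0 \<otimes>\<^bsub>H\<^esub> h \<otimes>\<^bsub>H\<^esub> inv\<^bsub>H\<^esub> h0 = h0 \<otimes>\<^bsub>H\<^esub> k \<otimes>\<^bsub>H\<^esub> inv\<^bsub>H\<^esub> h0" by (metis sq)
    then show "h = k" using hk h0 by simp
  qed
  moreover have "k \<in> D ` carrier H" if k: "k \<in> carrier H" for k
  proof -
    have "D (D (inv\<^bsub>H\<^esub> h0 \<otimes>\<^bsub>H\<^esub> k \<otimes>\<^bsub>H\<^esub> h0)) = k"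
      using k h0 by (simp add: sq H.m_assoc) (simp add: H.m_assoc[symmetric])
    then show ?thesis using k h0 DH by (metis H.inv_closed H.m_closed image_eqI)
  qed
  ultimately have "bij_betw D (carrier H) (carrier H)" using DH unfolding bij_betw_def by blast
  then have "D \<in> auto H" using D mult by (auto simp: auto_def Bij_def hom_def PiE_def)
  then show ?thesis using h0 Dh0 sq by (simp add: auto_pairs_def)
qed

text \<open>For \<open>x\<close> outside a subgroup of index 2, both \<open>x h\<close> and \<open>x\<^sup>2\<close> lie in a known coset, because the
  other coset would force \<open>x\<close> into the subgroup.\<close>

lemma realizes_ex:
  assumes "group H" and E: "(E, i) \<in> index2_overgroups H" and x: "x \<in> carrier E - i ` carrier H"
  shows "\<exists>p\<in>auto_pairs H. realizes H E i x p"
proof -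
  note E' = index2_overgroupsD[OF assms(1,2)]
  interpret H: group H by fact
  interpret E: group E by (fact E')
  interpret i: group_hom H E i using E' by unfold_locales
  note disj = coset_disjoint[OF assms(1) E'(1,2) x]
  have "\<exists>k\<in>carrier H. x \<otimes>\<^bsub>E\<^esub> i h = i k \<otimes>\<^bsub>E\<^esub> x" if h: "h \<in> carrier H" for h
  proof -
    have "x \<otimes>\<^bsub>E\<^esub> i h \<in> carrier E" using x h by auto
    from index2_overgroup_cases[OF assms this] show ?thesis using disj(2)[OF h] by metis
  qed
  then obtain d where d: "\<And>h. h \<in> carrier H \<Longrightarrow> d h \<in> carrier H \<and> x \<otimes>\<^bsub>E\<^esub> i h = i (d h) \<otimes>\<^bsub>E\<^esub> x"
    by metis
  have "x \<otimes>\<^bsub>E\<^esub> x \<in> carrier E" using x by auto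
  from index2_overgroup_cases[OF assms this]
  obtain h0 where h0: "h0 \<in> carrier H" "x \<otimes>\<^bsub>E\<^esub> x = i h0"
  proof cases
    case (2 h)
    then have "x = i h" using x by auto
    with 2 x show thesis by blast
  qed
  have "realizes H E i x (h0, restrict d (carrier H))" using x d h0 by (simp add: realizes_def)
  moreover from this have "(h0, restrict d (carrier H)) \<in> auto_pairs H"
    using d h0 by (intro auto_pairs_if_realizes[OF assms(1) E'(1-3)]) auto
  ultimately show ?thesis by blast
qed


section \<open>Unified products over a two-element set\<close>

lemma carrier_unified_product [simp]:
  "carrier (unified_product H S e q) = carrier H \<times> S"
  by (simp add: unified_product_def split: prod.splits)

lemma one_unified_product [simp]:
  "\<one>\<^bsub>unified_product H S e q\<^esub> = (\<one>\<^bsub>H\<^esub>, e)"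
  by (simp add: unified_product_def split: prod.splits)

lemma mult_pair_product:
  assumes "group H" "e \<noteq> c" and p: "(h0, D) \<in> auto_pairs H"
    and "h \<in> carrier H" "k \<in> carrier H"
  defines "G \<equiv> unified_product H {e, c} e (quad_of_pair H e c (h0, D))"
  shows "(h, e) \<otimes>\<^bsub>G\<^esub> (k, e) = (h \<otimes>\<^bsub>H\<^esub> k, e)"
    and "(h, e) \<otimes>\<^bsub>G\<^esub> (k, c) = (h \<otimes>\<^bsub>H\<^esub> k, c)"
    and "(h, c) \<otimes>\<^bsub>G\<^esub> (k, e) = (h \<otimes>\<^bsub>H\<^esub> D k, c)"
    and "(h, c) \<otimes>\<^bsub>G\<^esub> (k, c) = (h \<otimes>\<^bsub>H\<^esub> D k \<otimes>\<^bsub>H\<^esub> h0, e)"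
proof -
  interpret H: group H by fact
  show "(h, e) \<otimes>\<^bsub>G\<^esub> (k, e) = (h \<otimes>\<^bsub>H\<^esub> k, e)"
    "(h, e) \<otimes>\<^bsub>G\<^esub> (k, c) = (h \<otimes>\<^bsub>H\<^esub> k, c)"
    "(h, c) \<otimes>\<^bsub>G\<^esub> (k, e) = (h \<otimes>\<^bsub>H\<^esub> D k, c)"
    "(h, c) \<otimes>\<^bsub>G\<^esub> (k, c) = (h \<otimes>\<^bsub>H\<^esub> D k \<otimes>\<^bsub>H\<^esub> h0, e)"
    using assms(2,4,5) auto_pairsD[OF assms(1) p]
    by (auto simp: G_def unified_product_def quad_of_pair_def)
qed

lemma pair_product_group:
  assumes "group H" "e \<noteq> c" and p: "(h0, D) \<in> auto_pairs H"
  shows "group (unified_product H {e, c} e (quad_of_pair H e c (h0, D)))" (is "group ?G")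
proof (rule groupI)
  interpret H: group H by fact
  note m = mult_pair_product[OF assms]
  note D = auto_pairsD[OF assms(1) p]
  show "x \<otimes>\<^bsub>?G\<^esub> y \<in> carrier ?G" if "x \<in> carrier ?G" "y \<in> carrier ?G" for x y
    using that D by (auto simp: m)
  show "\<one>\<^bsub>?G\<^esub> \<in> carrier ?G" by simp
  show "\<one>\<^bsub>?G\<^esub> \<otimes>\<^bsub>?G\<^esub> x = x" if "x \<in> carrier ?G" for x
    using that by (auto simp: m)
  \<comment> \<open>Moving \<open>h0\<close> to the left past \<open>D (D h)\<close> normalizes both sides of the associative law.\<close>
  have sq: "D (D h) \<otimes>\<^bsub>H\<^esub> (h0 \<otimes>\<^bsub>H\<^esub> k) = h0 \<otimes>\<^bsub>H\<^esub> (h \<otimes>\<^bsub>H\<^esub> k)"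
    if "h \<in> carrier H" "k \<in> carrier H" for h k
    using that D by (simp add: H.m_assoc[symmetric])
  show "x \<otimes>\<^bsub>?G\<^esub> y \<otimes>\<^bsub>?G\<^esub> z = x \<otimes>\<^bsub>?G\<^esub> (y \<otimes>\<^bsub>?G\<^esub> z)"
    if "x \<in> carrier ?G" "y \<in> carrier ?G" "z \<in> carrier ?G" for x y z
    using that D(1-5,7) sq by (auto simp: m H.m_assoc)
  show "\<exists>y\<in>carrier ?G. y \<otimes>\<^bsub>?G\<^esub> x = \<one>\<^bsub>?G\<^esub>" if x: "x \<in> carrier ?G" for x
  proof -
    obtain h where h: "h \<in> carrier H" "x = (h, e) \<or> x = (h, c)" using x by auto
    have "(inv\<^bsub>H\<^esub> h, e) \<otimes>\<^bsub>?G\<^esub> (h, e) = \<one>\<^bsub>?G\<^esub>" using h by (simp add: m)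
    moreover have "(inv\<^bsub>H\<^esub> (D h \<otimes>\<^bsub>H\<^esub> h0), c) \<otimes>\<^bsub>?G\<^esub> (h, c) = \<one>\<^bsub>?G\<^esub>"
      using h D by (simp add: m H.m_assoc)
    moreover have "(inv\<^bsub>H\<^esub> h, e) \<in> carrier ?G" "(inv\<^bsub>H\<^esub> (D h \<otimes>\<^bsub>H\<^esub> h0), c) \<in> carrier ?G"
      using h D by auto
    ultimately show ?thesis using h(2) by blast
  qed
qed

text \<open>Stated for an arbitrary group extending structure, since the structure maps are recovered
  from the pair that \<open>(1, c)\<close> realizes in its unified product.\<close>

lemma unified_product_index2_overgroup:
  assumes "group H" "e \<noteq> c" and q: "q \<in> GES H {e, c} e"
  shows "(unified_product H {e, c} e q, \<lambda>h. (h, e)) \<in> index2_overgroups H"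
proof -
  interpret H: group H by fact
  obtain ast tl tr f where qd: "q = (ast, tl, tr, f)" by (metis prod_cases4)
  let ?G = "unified_product H {e, c} e q"
  let ?i = "\<lambda>h. (h, e)"
  have G: "group ?G" and dat: "extending_datum H {e, c} e q" using q by (auto simp: GES_def)
  have m: "(h, e) \<otimes>\<^bsub>?G\<^esub> (k, s) = (h \<otimes>\<^bsub>H\<^esub> k, s)"
    if "h \<in> carrier H" "k \<in> carrier H" "s \<in> {e, c}" for h k s
    using dat that unfolding qd extending_datum_def unified_product_def by auto
  have i: "?i \<in> hom H ?G" by (auto simp: hom_def m)
  have sub: "subgroup (?i ` carrier H) ?G"
    using assms(1) G i by (intro group_hom.img_is_subgroup) (simp add: group_hom_def group_hom_axioms_def)
  have x: "(\<one>\<^bsub>H\<^esub>, c) \<in> carrier ?G - ?i ` carrier H" using assms(2) by auto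
  have "?i ` carrier H #>\<^bsub>?G\<^esub> (\<one>\<^bsub>H\<^esub>, c) = (\<lambda>h. (h, c)) ` carrier H"
    by (auto simp: r_coset_def m)
  then have "carrier ?G = ?i ` carrier H \<union> (?i ` carrier H #>\<^bsub>?G\<^esub> (\<one>\<^bsub>H\<^esub>, c))" by auto
  then have "card (rcosets\<^bsub>?G\<^esub> (?i ` carrier H)) = 2"
    using group.card_rcosets_eq_2_iff[OF G sub x] by blast
  then show ?thesis using G i by (auto simp: index2_overgroups_def inj_on_def)
qed

lemma quad_of_pair_in_GES:
  assumes "group H" "e \<noteq> c" and "p \<in> auto_pairs H"
  shows "quad_of_pair H e c p \<in> GES H {e, c} e"
proof -
  interpret H: group H by fact
  obtain h0 D where p: "p = (h0, D)" by force
  have "extending_datum H {e, c} e (quad_of_pair H e c (h0, D))"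
    using assms(2) auto_pairsD[OF assms(1) assms(3)[unfolded p]]
    by (auto simp: extending_datum_def quad_of_pair_def)
  then show ?thesis using pair_product_group[OF assms(1,2)] assms(3) by (simp add: GES_def p)
qed

lemma pair_overgroup_index2:
  assumes "group H" "e \<noteq> c" "p \<in> auto_pairs H"
  shows "pair_overgroup H e c p \<in> index2_overgroups H"
  unfolding pair_overgroup_def
  using unified_product_index2_overgroup[OF assms(1,2) quad_of_pair_in_GES[OF assms]] .

text \<open>For surjectivity, the unified product of a structure \<open>q\<close> contains \<open>H\<close> with index 2, so \<open>(1, c)\<close>
  realizes some pair there. Computing \<open>(1, c) (h, e)\<close> and \<open>(1, c)\<^sup>2\<close> both from \<open>q\<close> and from that
  pair shows that \<open>q\<close> is the structure of the pair.\<close>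

lemma bij_betw_quad_of_pair:
  assumes "group H" "e \<noteq> c"
  shows "bij_betw (quad_of_pair H e c) (auto_pairs H) (GES H {e, c} e)"
proof -
  interpret H: group H by fact
  have "inj_on (quad_of_pair H e c) (auto_pairs H)"
  proof (rule inj_onI, clarify)
    fix h0 D h0' D'
    assume p: "(h0, D) \<in> auto_pairs H" and p': "(h0', D') \<in> auto_pairs H"
      and eq: "quad_of_pair H e c (h0, D) = quad_of_pair H e c (h0', D')"
    have f: "(\<lambda>(s, t)\<in>{e, c} \<times> {e, c}. if s = c \<and> t = c then h0 else \<one>\<^bsub>H\<^esub>)
        = (\<lambda>(s, t)\<in>{e, c} \<times> {e, c}. if s = c \<and> t = c then h0' else \<one>\<^bsub>H\<^esub>)"
      and tr: "(\<lambda>(s, h)\<in>{e, c} \<times> carrier H. if s = c then D h else h)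
        = (\<lambda>(s, h)\<in>{e, c} \<times> carrier H. if s = c then D' h else h)"
      using eq unfolding quad_of_pair_def prod.case prod.inject by blast+
    have "D h = D' h" if "h \<in> carrier H" for h
      using fun_cong[OF tr, of "(c, h)"] that by simp
    then have "D = D'"
      using auto_pairsD(6)[OF assms(1) p] auto_pairsD(6)[OF assms(1) p'] by (metis extensionalityI)
    then show "h0 = h0' \<and> D = D'" using fun_cong[OF f, of "(c, c)"] by simp
  qed
  moreover have "q \<in> quad_of_pair H e c ` auto_pairs H" if q: "q \<in> GES H {e, c} e" for q
  proof -
    obtain ast tl tr f where qd: "q = (ast, tl, tr, f)" by (metis prod_cases4)
    let ?G = "unified_product H {e, c} e q"
    have dat: "extending_datum H {e, c} e q" using q by (auto simp: GES_def)
    have x: "(\<one>\<^bsub>H\<^esub>, c) \<in> carrier ?G - (\<lambda>h. (h, e)) ` carrier H" using assms(2) by auto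
    obtain h0 D where p: "(h0, D) \<in> auto_pairs H"
      and r: "realizes H ?G (\<lambda>h. (h, e)) (\<one>\<^bsub>H\<^esub>, c) (h0, D)"
      using realizes_ex[OF assms(1) unified_product_index2_overgroup[OF assms q] x] by auto
    note D = auto_pairsD[OF assms(1) p]
    have dat': "ast \<in> {e, c} \<times> {e, c} \<rightarrow>\<^sub>E {e, c}" "tl \<in> {e, c} \<times> carrier H \<rightarrow>\<^sub>E {e, c}"
        "tr \<in> {e, c} \<times> carrier H \<rightarrow>\<^sub>E carrier H" "f \<in> {e, c} \<times> {e, c} \<rightarrow>\<^sub>E carrier H"
      and ast: "\<And>s. s \<in> {e, c} \<Longrightarrow> ast (s, e) = s \<and> ast (e, s) = s"
      and tl: "\<And>s. s \<in> {e, c} \<Longrightarrow> tl (s, \<one>\<^bsub>H\<^esub>) = s" "\<And>h. h \<in> carrier H \<Longrightarrow> tl (e, h) = e"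
      and tr: "\<And>h. h \<in> carrier H \<Longrightarrow> tr (e, h) = h" "\<And>s. s \<in> {e, c} \<Longrightarrow> tr (s, \<one>\<^bsub>H\<^esub>) = \<one>\<^bsub>H\<^esub>"
      and f: "\<And>s. s \<in> {e, c} \<Longrightarrow> f (s, e) = \<one>\<^bsub>H\<^esub> \<and> f (e, s) = \<one>\<^bsub>H\<^esub>"
      using dat unfolding qd extending_datum_def prod.case by blast+
    have ran: "tl (c, h) \<in> {e, c}" "tr (c, h) \<in> carrier H" if "h \<in> carrier H" for h
      using dat' that by (auto simp: PiE_iff)
    have fc: "f (c, c) \<in> carrier H" using dat' by (auto simp: PiE_iff)
    \<comment> \<open>Comparing \<open>(1, c) (h, e) = (D h, e) (1, c)\<close> componentwise gives both actions.\<close>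
    have "tr (c, h) = D h \<and> tl (c, h) = c" if h: "h \<in> carrier H" for h
    proof -
      have "(\<one>\<^bsub>H\<^esub>, c) \<otimes>\<^bsub>?G\<^esub> (h, e) = (D h, e) \<otimes>\<^bsub>?G\<^esub> (\<one>\<^bsub>H\<^esub>, c)"
        using r h by (simp add: realizes_def)
      then show ?thesis using h ran[OF h] D(2)[OF h] ast tl tr f
        by (simp add: qd unified_product_def)
    qed
    moreover have "f (c, c) = h0 \<and> ast (c, c) = e"
    proof -
      have "(\<one>\<^bsub>H\<^esub>, c) \<otimes>\<^bsub>?G\<^esub> (\<one>\<^bsub>H\<^esub>, c) = (h0, e)" using r by (simp add: realizes_def)
      then show ?thesis using fc tl tr by (simp add: qd unified_product_def)
    qed
    ultimately have ctr: "\<And>h. h \<in> carrier H \<Longrightarrow> tr (c, h) = D h"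
      and ctl: "\<And>h. h \<in> carrier H \<Longrightarrow> tl (c, h) = c" and cf: "f (c, c) = h0" and cast: "ast (c, c) = e"
      by blast+
    have ext: "ast \<in> extensional ({e, c} \<times> {e, c})" "tl \<in> extensional ({e, c} \<times> carrier H)"
        "tr \<in> extensional ({e, c} \<times> carrier H)" "f \<in> extensional ({e, c} \<times> {e, c})"
      using dat' by (simp_all only: PiE_iff)
    have "ast = (\<lambda>(s, t)\<in>{e, c} \<times> {e, c}. if s = e then t else if t = e then s else e)"
      by (rule extensionalityI[OF ext(1) restrict_extensional]) (use assms(2) ast[of e] ast[of c] cast in auto)
    moreover have "tl = (\<lambda>(s, h)\<in>{e, c} \<times> carrier H. s)"
      by (rule extensionalityI[OF ext(2) restrict_extensional]) (use tl(2) ctl in auto)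
    moreover have "tr = (\<lambda>(s, h)\<in>{e, c} \<times> carrier H. if s = c then D h else h)"
      by (rule extensionalityI[OF ext(3) restrict_extensional]) (use assms(2) tr(1) ctr in auto)
    moreover have "f = (\<lambda>(s, t)\<in>{e, c} \<times> {e, c}. if s = c \<and> t = c then h0 else \<one>\<^bsub>H\<^esub>)"
      by (rule extensionalityI[OF ext(4) restrict_extensional]) (use f[of e] f[of c] cf in auto)
    ultimately have "q = quad_of_pair H e c (h0, D)"
      unfolding qd quad_of_pair_def prod.case prod.inject by blast
    then show ?thesis using p by blast
  qed
  ultimately show ?thesis using quad_of_pair_in_GES[OF assms] unfolding bij_betw_def by blast
qed


section \<open>Isomorphisms over the subgroup\<close>

lemma (in group) mult_eq_mult_iff_conjugate:
  assumes "x \<in> carrier G" "y \<in> carrier G" "g \<in> carrier G"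
  shows "x \<otimes> g = g \<otimes> y \<longleftrightarrow> x = g \<otimes> y \<otimes> inv g"
  using assms by (metis inv_solve_right' m_closed)

lemma iso_stabilizing_refl: "iso_stabilizing H X X"
  by (cases X) (auto simp: iso_stabilizing_def intro!: bexI[OF _ id_iso])

lemma iso_stabilizing_sym:
  assumes "group H" "X \<in> index2_overgroups H" "iso_stabilizing H X Y"
  shows "iso_stabilizing H Y X"
proof -
  obtain E i E' i' where XY: "X = (E, i)" "Y = (E', i')" by force
  note E = index2_overgroupsD[OF assms(1) assms(2)[unfolded XY]]
  obtain \<psi> where \<psi>: "\<psi> \<in> iso E E'" "\<forall>h\<in>carrier H. \<psi> (i h) = i' h"
    using assms(3) by (auto simp: iso_stabilizing_def XY)
  have "inv_into (carrier E) \<psi> (i' h) = i h" if "h \<in> carrier H" for h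
    using that \<psi> E(2) by (metis hom_in_carrier inv_into_f_f iso_iff)
  then show ?thesis
    using group.iso_set_sym[OF E(1) \<psi>(1)] by (auto simp: iso_stabilizing_def XY)
qed

lemma iso_stabilizing_trans:
  assumes "iso_stabilizing H X Y" "iso_stabilizing H Y Z"
  shows "iso_stabilizing H X Z"
proof -
  obtain E i E' i' E'' i'' where XYZ: "X = (E, i)" "Y = (E', i')" "Z = (E'', i'')" by (metis surj_pair)
  obtain \<psi> \<phi> where \<psi>: "\<psi> \<in> iso E E'" "\<forall>h\<in>carrier H. \<psi> (i h) = i' h"
    and \<phi>: "\<phi> \<in> iso E' E''" "\<forall>h\<in>carrier H. \<phi> (i' h) = i'' h"
    using assms by (auto simp: iso_stabilizing_def XYZ)
  then have "\<phi> \<circ> \<psi> \<in> iso E E''" by (intro iso_set_trans)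
  moreover have "\<forall>h\<in>carrier H. (\<phi> \<circ> \<psi>) (i h) = i'' h" using \<psi> \<phi> by simp
  ultimately show ?thesis unfolding iso_stabilizing_def XYZ by blast
qed

lemma equiv_overgroup_rel:
  assumes "group H"
  shows "equiv (index2_overgroups H) (overgroup_rel H)"
proof (rule equivI)
  show "overgroup_rel H \<subseteq> index2_overgroups H \<times> index2_overgroups H"
    by (auto simp: overgroup_rel_def)
  show "refl_on (index2_overgroups H) (overgroup_rel H)"
    by (auto simp: refl_on_def overgroup_rel_def iso_stabilizing_refl)
  show "sym (overgroup_rel H)"
    by (auto simp: sym_def overgroup_rel_def intro: iso_stabilizing_sym[OF assms])
  show "trans (overgroup_rel H)"
    by (auto simp: trans_def overgroup_rel_def intro: iso_stabilizing_trans)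
qed

text \<open>An isomorphism sends \<open>(1, c)\<close> to an element realizing the pair. Conversely, if \<open>x\<close> realizes
  it, then \<open>(h, e) \<mapsto> h\<close> and \<open>(h, c) \<mapsto> h x\<close> is an isomorphism: it is bijective by the decomposition
  into two cosets, and multiplicative since products in \<open>E\<close> are governed by \<open>x h = D h x\<close> and
  \<open>x\<^sup>2 = h0\<close>.\<close>

lemma iso_stabilizing_iff_realizes:
  assumes "group H" "e \<noteq> c" and p: "p \<in> auto_pairs H" and E: "(E, i) \<in> index2_overgroups H"
  shows "iso_stabilizing H (pair_overgroup H e c p) (E, i) \<longleftrightarrow> (\<exists>x. realizes H E i x p)"
proof -
  obtain h0 D where pd: "p = (h0, D)" by force
  let ?G = "unified_product H {e, c} e (quad_of_pair H e c (h0, D))"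
  note m = mult_pair_product[OF assms(1,2) p[unfolded pd]]
  note D = auto_pairsD[OF assms(1) p[unfolded pd]]
  note E' = index2_overgroupsD[OF assms(1) E]
  interpret H: group H by fact
  interpret E: group E by (fact E')
  interpret i: group_hom H E i using E' by unfold_locales
  show ?thesis
  proof
    assume "iso_stabilizing H (pair_overgroup H e c p) (E, i)"
    then obtain \<psi> where \<psi>: "\<psi> \<in> iso ?G E" and \<psi>i: "\<And>h. h \<in> carrier H \<Longrightarrow> \<psi> (h, e) = i h"
      by (auto simp: iso_stabilizing_def pair_overgroup_def pd)
    have mult: "\<psi> (a \<otimes>\<^bsub>?G\<^esub> b) = \<psi> a \<otimes>\<^bsub>E\<^esub> \<psi> b" if "a \<in> carrier ?G" "b \<in> carrier ?G" for a b
      using \<psi> that by (auto simp: iso_def hom_def)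
    have inj: "inj_on \<psi> (carrier ?G)" and ran: "\<psi> (\<one>\<^bsub>H\<^esub>, c) \<in> carrier E"
      using \<psi> by (auto simp: iso_def bij_betw_def hom_def)
    have "\<psi> (\<one>\<^bsub>H\<^esub>, c) \<noteq> i h" if h: "h \<in> carrier H" for h
      using inj_onD[OF inj, of "(\<one>\<^bsub>H\<^esub>, c)" "(h, e)"] \<psi>i[OF h] h assms(2) by auto
    moreover have "\<psi> (\<one>\<^bsub>H\<^esub>, c) \<otimes>\<^bsub>E\<^esub> \<psi> (\<one>\<^bsub>H\<^esub>, c) = i h0"
      using D by (simp add: mult[symmetric] m \<psi>i)
    moreover have "\<psi> (\<one>\<^bsub>H\<^esub>, c) \<otimes>\<^bsub>E\<^esub> i h = i (D h) \<otimes>\<^bsub>E\<^esub> \<psi> (\<one>\<^bsub>H\<^esub>, c)" if h: "h \<in> carrier H" for h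
      using D h by (simp add: mult[symmetric] m \<psi>i[symmetric])
    ultimately show "\<exists>x. realizes H E i x p" using ran by (auto simp: realizes_def pd)
  next
    assume "\<exists>x. realizes H E i x p"
    then obtain x where x: "x \<in> carrier E - i ` carrier H" and xx: "x \<otimes>\<^bsub>E\<^esub> x = i h0"
      and xi: "\<And>h. h \<in> carrier H \<Longrightarrow> x \<otimes>\<^bsub>E\<^esub> i h = i (D h) \<otimes>\<^bsub>E\<^esub> x"
      by (auto simp: realizes_def pd)
    have xE: "x \<in> carrier E" using x by blast
    note disj = coset_disjoint(1)[OF assms(1) E'(1,2) x]
    define \<psi> where "\<psi> = (\<lambda>(h, s). if s = e then i h else i h \<otimes>\<^bsub>E\<^esub> x)"
    have \<psi>: "\<psi> (h, e) = i h" "\<psi> (h, c) = i h \<otimes>\<^bsub>E\<^esub> x" for h using assms(2) by (auto simp: \<psi>_def)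
    have xi': "x \<otimes>\<^bsub>E\<^esub> (i h \<otimes>\<^bsub>E\<^esub> y) = i (D h) \<otimes>\<^bsub>E\<^esub> (x \<otimes>\<^bsub>E\<^esub> y)"
      if "h \<in> carrier H" "y \<in> carrier E" for h y
      using that xE xi D(2) by (simp add: E.m_assoc[symmetric])
    have "\<psi> \<in> hom ?G E"
    proof (rule homI)
      show "\<psi> a \<in> carrier E" if "a \<in> carrier ?G" for a using that xE by (auto simp: \<psi>)
      show "\<psi> (a \<otimes>\<^bsub>?G\<^esub> b) = \<psi> a \<otimes>\<^bsub>E\<^esub> \<psi> b" if "a \<in> carrier ?G" "b \<in> carrier ?G" for a b
        using that xE D by (auto simp: \<psi> m E.m_assoc xi xi' xx)
    qed
    moreover have "inj_on \<psi> (carrier ?G)"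
    proof (rule inj_onI)
      fix a b assume "a \<in> carrier ?G" "b \<in> carrier ?G" "\<psi> a = \<psi> b"
      then show "a = b"
        using xE disj disj[symmetric] E'(3) by (auto simp: \<psi> inj_on_eq_iff)
    qed
    moreover have "carrier E \<subseteq> \<psi> ` carrier ?G"
    proof
      fix y assume "y \<in> carrier E"
      from index2_overgroup_cases[OF assms(1) E x this] obtain h s
        where "h \<in> carrier H" "s \<in> {e, c}" "y = \<psi> (h, s)" using \<psi> by (metis insertCI)
      then show "y \<in> \<psi> ` carrier ?G" by auto
    qed
    ultimately have "\<psi> \<in> iso ?G E" by (auto simp: iso_def bij_betw_def hom_def)
    then show "iso_stabilizing H (pair_overgroup H e c p) (E, i)"
      using \<psi> by (auto simp: iso_stabilizing_def pair_overgroup_def pd)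
  qed
qed

lemma iso_stabilizing_iff_pair_rel:
  assumes "group H" "e \<noteq> c" and p: "p \<in> auto_pairs H" and p': "p' \<in> auto_pairs H"
  shows "iso_stabilizing H (pair_overgroup H e c p) (pair_overgroup H e c p') \<longleftrightarrow>
    (p, p') \<in> pair_rel H"
proof -
  interpret H: group H by fact
  obtain h0 D h0' D' where pd: "p = (h0, D)" "p' = (h0', D')" by force
  let ?G = "unified_product H {e, c} e (quad_of_pair H e c (h0', D'))"
  note m = mult_pair_product[OF assms(1,2) p'[unfolded pd]]
  note D = auto_pairsD[OF assms(1) p[unfolded pd]]
  note D' = auto_pairsD[OF assms(1) p'[unfolded pd]]
  have conj: "D h \<otimes>\<^bsub>H\<^esub> g = g \<otimes>\<^bsub>H\<^esub> D' h \<longleftrightarrow> D h = g \<otimes>\<^bsub>H\<^esub> D' h \<otimes>\<^bsub>H\<^esub> inv\<^bsub>H\<^esub> g"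
    if "g \<in> carrier H" "h \<in> carrier H" for g h
    using that D(2) D'(2) by (simp add: H.mult_eq_mult_iff_conjugate)
  have "realizes H ?G (\<lambda>h. (h, e)) x (h0, D) \<longleftrightarrow>
      (\<exists>g\<in>carrier H. x = (g, c) \<and> h0 = g \<otimes>\<^bsub>H\<^esub> D' g \<otimes>\<^bsub>H\<^esub> h0' \<and>
        (\<forall>h\<in>carrier H. D h = g \<otimes>\<^bsub>H\<^esub> D' h \<otimes>\<^bsub>H\<^esub> inv\<^bsub>H\<^esub> g))" for x
    using assms(2) D D' by (auto simp: realizes_def m conj[symmetric])
  then have "(\<exists>x. realizes H ?G (\<lambda>h. (h, e)) x (h0, D)) \<longleftrightarrow> (p, p') \<in> pair_rel H"
    using p p' by (auto simp: pair_rel_def pd)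
  moreover have "pair_overgroup H e c p' = (?G, \<lambda>h. (h, e))" by (simp add: pair_overgroup_def pd)
  ultimately show ?thesis
    using iso_stabilizing_iff_realizes[OF assms(1,2) p]
      pair_overgroup_index2[OF assms(1,2) p'] pd by metis
qed

lemma ex_pair_overgroup_iso:
  assumes "group H" "e \<noteq> c" and X: "X \<in> index2_overgroups H"
  shows "\<exists>p\<in>auto_pairs H. iso_stabilizing H (pair_overgroup H e c p) X"
proof -
  obtain E i where Xd: "X = (E, i)" by force
  note E = index2_overgroupsD[OF assms(1) X[unfolded Xd]]
  obtain x where "x \<in> carrier E - i ` carrier H"
    using group.ex_notin_if_card_rcosets_eq_2[OF E(1,4,5)] by blast
  then show ?thesis
    using realizes_ex[OF assms(1) X[unfolded Xd]] iso_stabilizing_iff_realizes[OF assms(1,2)] X Xd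
    by metis
qed

lemma equiv_pair_rel:
  fixes H :: "('h, 'm) monoid_scheme"
  assumes "group H"
  shows "equiv (auto_pairs H) (pair_rel H)"
proof -
  \<comment> \<open>Any two-element pointed set serves as index set for the second coset.\<close>
  let ?F = "pair_overgroup H False True"
  have F: "?F p \<in> index2_overgroups H" if "p \<in> auto_pairs H" for p
    using pair_overgroup_index2[OF assms _ that, of False True] by simp
  have iff: "(p, q) \<in> pair_rel H \<longleftrightarrow> (?F p, ?F q) \<in> overgroup_rel H"
    if "p \<in> auto_pairs H" "q \<in> auto_pairs H" for p q
    using iso_stabilizing_iff_pair_rel[OF assms _ that, of False True] F that
    by (simp add: overgroup_rel_def)
  show ?thesis
    by (rule equiv_pullback[OF equiv_overgroup_rel[OF assms] _ _ iff])
      (use F in \<open>auto simp: pair_rel_def\<close>)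
qed


section \<open>Equivalence of group extending structures\<close>

text \<open>A bijection \<open>v\<close> of \<open>{e, c}\<close> fixing \<open>e\<close> is the identity, and \<open>r\<close> is determined by \<open>g = r c\<close>.
  The conditions at \<open>e\<close> are trivial, and those at \<open>c\<close> are the two equations of \<open>pair_rel\<close>.\<close>

lemma GES_rel_iff_pair_rel:
  assumes "group H" "e \<noteq> c" and p: "p \<in> auto_pairs H" and p': "p' \<in> auto_pairs H"
  shows "(quad_of_pair H e c p, quad_of_pair H e c p') \<in> GES_rel H {e, c} e \<longleftrightarrow>
    (p, p') \<in> pair_rel H"
proof -
  interpret H: group H by fact
  obtain h0 D h0' D' where pd: "p = (h0, D)" "p' = (h0', D')" by force
  note D = auto_pairsD[OF assms(1) p[unfolded pd]]
  note D' = auto_pairsD[OF assms(1) p'[unfolded pd]]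
  have conj: "D h \<otimes>\<^bsub>H\<^esub> g = g \<otimes>\<^bsub>H\<^esub> D' h \<longleftrightarrow> D h = g \<otimes>\<^bsub>H\<^esub> D' h \<otimes>\<^bsub>H\<^esub> inv\<^bsub>H\<^esub> g"
    if "g \<in> carrier H" "h \<in> carrier H" for g h
    using that D(2) D'(2) by (simp add: H.mult_eq_mult_iff_conjugate)
  note q = quad_of_pair_in_GES[OF assms(1,2) p, unfolded pd]
    quad_of_pair_in_GES[OF assms(1,2) p', unfolded pd]
  obtain ast tl tr f where Q: "quad_of_pair H e c p = (ast, tl, tr, f)" by (metis prod_cases4)
  obtain ast' tl' tr' f' where Q': "quad_of_pair H e c p' = (ast', tl', tr', f')"
    by (metis prod_cases4)
  have maps: "ast (c, c) = e" "\<And>h. h \<in> carrier H \<Longrightarrow> tl (c, h) = c"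
      "\<And>h. h \<in> carrier H \<Longrightarrow> tr (c, h) = D h" "f (c, c) = h0"
    and maps': "\<And>h. h \<in> carrier H \<Longrightarrow> tl' (c, h) = c"
      "\<And>h. h \<in> carrier H \<Longrightarrow> tr' (c, h) = D' h" "f' (c, c) = h0'"
    using Q Q' assms(2) by (auto simp: pd quad_of_pair_def)
  show ?thesis
  proof
    assume "(quad_of_pair H e c p, quad_of_pair H e c p') \<in> GES_rel H {e, c} e"
    then obtain r v where r: "r \<in> {e, c} \<rightarrow> carrier H" "r e = \<one>\<^bsub>H\<^esub>"
      and v: "bij_betw v {e, c} {e, c}" "v e = e"
      and rv: "\<forall>s\<in>{e, c}. \<forall>h\<in>carrier H. tr (s, h) \<otimes>\<^bsub>H\<^esub> r (tl (s, h)) = r s \<otimes>\<^bsub>H\<^esub> tr' (v s, h)"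
        "\<forall>s\<in>{e, c}. \<forall>t\<in>{e, c}. f (s, t) \<otimes>\<^bsub>H\<^esub> r (ast (s, t)) =
          r s \<otimes>\<^bsub>H\<^esub> tr' (v s, r t) \<otimes>\<^bsub>H\<^esub> f' (tl' (v s, r t), v t)"
      unfolding GES_rel_def Q Q' by blast
    have vc: "v c = c" using v assms(2) by (auto simp: bij_betw_def)
    have g: "r c \<in> carrier H" using r by auto
    have "D h \<otimes>\<^bsub>H\<^esub> r c = r c \<otimes>\<^bsub>H\<^esub> D' h" if "h \<in> carrier H" for h
      using bspec[OF bspec[OF rv(1), of c] that] that by (simp add: vc maps maps')
    moreover have "h0 = r c \<otimes>\<^bsub>H\<^esub> D' (r c) \<otimes>\<^bsub>H\<^esub> h0'"
      using bspec[OF bspec[OF rv(2), of c], of c] g D(1) by (simp add: vc r(2) maps maps')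
    ultimately show "(p, p') \<in> pair_rel H"
      using p p' g conj by (auto simp: pair_rel_def pd)
  next
    assume "(p, p') \<in> pair_rel H"
    then obtain g where g: "g \<in> carrier H" "h0 = g \<otimes>\<^bsub>H\<^esub> D' g \<otimes>\<^bsub>H\<^esub> h0'"
        "\<And>h. h \<in> carrier H \<Longrightarrow> D h \<otimes>\<^bsub>H\<^esub> g = g \<otimes>\<^bsub>H\<^esub> D' h"
      using conj by (auto simp: pair_rel_def pd)
    show "(quad_of_pair H e c p, quad_of_pair H e c p') \<in> GES_rel H {e, c} e"
      using q unfolding GES_rel_def pd quad_of_pair_def prod.case mem_Collect_eq
      by (intro conjI exI[of _ "\<lambda>s. if s = c then g else \<one>\<^bsub>H\<^esub>"] exI[of _ "\<lambda>s. s"])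
        (use g D D' assms(2) in \<open>auto simp: bij_betw_def\<close>)
  qed
qed


section \<open>Classification\<close>

theorem proposition2p23:
  fixes H :: "('h, 'm) monoid_scheme" and S :: "'s set" and e c :: 's
  assumes "group H" and "S = {e, c}" and "e \<noteq> c"
  shows
    "bij_betw (quad_of_pair H e c) (auto_pairs H) (GES H S e) \<and>
     equiv (auto_pairs H) (pair_rel H) \<and>
     (\<exists>\<Phi>. bij_betw \<Phi> (K2 H S e) (auto_pairs H // pair_rel H) \<and>
       (\<forall>p\<in>auto_pairs H. \<Phi> (GES_rel H S e `` {quad_of_pair H e c p}) = pair_rel H `` {p})) \<and>
     (\<exists>\<Psi>. bij_betw \<Psi> (auto_pairs H // pair_rel H)
         ((index2_overgroups H :: (('h \<times> 's) monoid \<times> ('h \<Rightarrow> 'h \<times> 's)) set) // overgroup_rel H) \<and>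
       (\<forall>p\<in>auto_pairs H. \<Psi> (pair_rel H `` {p}) = overgroup_rel H `` {pair_overgroup H e c p})) \<and>
     (\<forall>X \<in> (index2_overgroups H :: ('e monoid \<times> ('h \<Rightarrow> 'e)) set).
       \<exists>!K. K \<in> auto_pairs H // pair_rel H \<and>
         (\<forall>p\<in>K. iso_stabilizing H (pair_overgroup H e c p) X)) \<and>
     (\<forall>(h0, D)\<in>auto_pairs H.
       let G = unified_product H S e (quad_of_pair H e c (h0, D)) in
       (\<forall>h1\<in>carrier H. \<forall>h2\<in>carrier H. (h1, e) \<otimes>\<^bsub>G\<^esub> (h2, e) = (h1 \<otimes>\<^bsub>H\<^esub> h2, e)) \<and>
       (\<one>\<^bsub>H\<^esub>, c) \<otimes>\<^bsub>G\<^esub> (\<one>\<^bsub>H\<^esub>, c) = (h0, e) \<and>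
       (\<forall>h\<in>carrier H. (h, e) \<otimes>\<^bsub>G\<^esub> (\<one>\<^bsub>H\<^esub>, c) = (h, c)) \<and>
       (\<forall>h\<in>carrier H. (\<one>\<^bsub>H\<^esub>, c) \<otimes>\<^bsub>G\<^esub> (h, e) = (D h, c)))"
proof (intro conjI)
  let ?F = "quad_of_pair H e c"
  note H = \<open>group H\<close> and ec = \<open>e \<noteq> c\<close>
  interpret H: group H by fact
  show bij: "bij_betw ?F (auto_pairs H) (GES H S e)"
    using bij_betw_quad_of_pair[OF H ec] assms(2) by simp
  show eq: "equiv (auto_pairs H) (pair_rel H)" by (rule equiv_pair_rel[OF H])
  show "\<exists>\<Phi>. bij_betw \<Phi> (K2 H S e) (auto_pairs H // pair_rel H) \<and>
       (\<forall>p\<in>auto_pairs H. \<Phi> (GES_rel H S e `` {?F p}) = pair_rel H `` {p})"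
  proof -
    define F' where "F' = the_inv_into (auto_pairs H) ?F"
    have F': "F' \<in> GES H S e \<rightarrow> auto_pairs H" and F'F: "\<And>p. p \<in> auto_pairs H \<Longrightarrow> F' (?F p) = p"
      and FF': "\<And>q. q \<in> GES H S e \<Longrightarrow> ?F (F' q) = q"
      using bij bij_betw_the_inv_into[OF bij] unfolding F'_def
      by (auto simp: bij_betw_def the_inv_into_f_f f_the_inv_into_f)
    have iff: "(q, q') \<in> GES_rel H S e \<longleftrightarrow> (F' q, F' q') \<in> pair_rel H"
      if "q \<in> GES H S e" "q' \<in> GES H S e" for q q'
      using GES_rel_iff_pair_rel[OF H ec, of "F' q" "F' q'"] FF' that F' assms(2) by (metis Pi_iff)
    have "equiv (GES H S e) (GES_rel H S e)"
      by (rule equiv_pullback[OF eq F' _ iff]) (auto simp: GES_rel_def)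
    moreover have "\<exists>q\<in>GES H S e. (F' q, p) \<in> pair_rel H" if p: "p \<in> auto_pairs H" for p
      using F'F[OF p] p bij eq by (metis bij_betwE equiv_def refl_onD)
    ultimately obtain \<Phi> where "bij_betw \<Phi> (GES H S e // GES_rel H S e) (auto_pairs H // pair_rel H)"
      and \<Phi>: "\<forall>q\<in>GES H S e. \<Phi> (GES_rel H S e `` {q}) = pair_rel H `` {F' q}"
      using bij_betw_quotients[OF _ eq F' iff] by auto
    moreover have "\<Phi> (GES_rel H S e `` {?F p}) = pair_rel H `` {p}" if p: "p \<in> auto_pairs H" for p
      using \<Phi> F'F[OF p] bij_betwE[OF bij] p by auto
    ultimately show ?thesis unfolding K2_def by blast
  qed
  show "\<exists>\<Psi>. bij_betw \<Psi> (auto_pairs H // pair_rel H)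
         ((index2_overgroups H :: (('h \<times> 's) monoid \<times> ('h \<Rightarrow> 'h \<times> 's)) set) // overgroup_rel H) \<and>
       (\<forall>p\<in>auto_pairs H. \<Psi> (pair_rel H `` {p}) = overgroup_rel H `` {pair_overgroup H e c p})"
  proof (rule bij_betw_quotients[OF eq equiv_overgroup_rel[OF H]])
    show "pair_overgroup H e c \<in> auto_pairs H \<rightarrow> index2_overgroups H"
      using pair_overgroup_index2[OF H ec] by blast
    show "(p, q) \<in> pair_rel H \<longleftrightarrow> (pair_overgroup H e c p, pair_overgroup H e c q) \<in> overgroup_rel H"
      if "p \<in> auto_pairs H" "q \<in> auto_pairs H" for p q
      using that iso_stabilizing_iff_pair_rel[OF H ec] pair_overgroup_index2[OF H ec]
      by (simp add: overgroup_rel_def)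
    show "\<exists>p\<in>auto_pairs H. (pair_overgroup H e c p, X) \<in> overgroup_rel H"
      if "X \<in> index2_overgroups H" for X
      using ex_pair_overgroup_iso[OF H ec that] pair_overgroup_index2[OF H ec] that
      by (auto simp: overgroup_rel_def)
  qed
  show "\<forall>X \<in> (index2_overgroups H :: ('e monoid \<times> ('h \<Rightarrow> 'e)) set).
       \<exists>!K. K \<in> auto_pairs H // pair_rel H \<and>
         (\<forall>p\<in>K. iso_stabilizing H (pair_overgroup H e c p) X)"
  proof
    fix X :: "'e monoid \<times> ('h \<Rightarrow> 'e)" assume X: "X \<in> index2_overgroups H"
    obtain p where p: "p \<in> auto_pairs H" "iso_stabilizing H (pair_overgroup H e c p) X"
      using ex_pair_overgroup_iso[OF H ec X] by blast
    have cls: "iso_stabilizing H (pair_overgroup H e c q) X \<longleftrightarrow> (p, q) \<in> pair_rel H"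
      if q: "q \<in> auto_pairs H" for q
      using iso_stabilizing_iff_pair_rel[OF H ec p(1) q] p(2)
        iso_stabilizing_trans[of H "pair_overgroup H e c p" X "pair_overgroup H e c q"]
        iso_stabilizing_trans[of H "pair_overgroup H e c q" "pair_overgroup H e c p" X]
        iso_stabilizing_sym[OF H pair_overgroup_index2[OF H ec q], of X]
        iso_stabilizing_sym[OF H pair_overgroup_index2[OF H ec p(1)],
          of "pair_overgroup H e c q"] by blast
    have sub: "pair_rel H \<subseteq> auto_pairs H \<times> auto_pairs H" by (auto simp: pair_rel_def)
    show "\<exists>!K. K \<in> auto_pairs H // pair_rel H \<and>
         (\<forall>p\<in>K. iso_stabilizing H (pair_overgroup H e c p) X)"
    proof (rule ex1I[of _ "pair_rel H `` {p}"])
      show "pair_rel H `` {p} \<in> auto_pairs H // pair_rel H \<and>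
          (\<forall>q\<in>pair_rel H `` {p}. iso_stabilizing H (pair_overgroup H e c q) X)"
        using p(1) cls sub by (auto intro: quotientI)
      fix K assume K: "K \<in> auto_pairs H // pair_rel H \<and>
          (\<forall>q\<in>K. iso_stabilizing H (pair_overgroup H e c q) X)"
      then obtain q where q: "q \<in> auto_pairs H" "K = pair_rel H `` {q}" by (auto elim: quotientE)
      then have "q \<in> K" using equiv_class_self[OF eq] by simp
      then have "(p, q) \<in> pair_rel H" using K cls q(1) by blast
      then show "K = pair_rel H `` {p}" using q eq by (metis equiv_class_eq)
    qed
  qed
  show "\<forall>(h0, D)\<in>auto_pairs H.
       let G = unified_product H S e (quad_of_pair H e c (h0, D)) in
       (\<forall>h1\<in>carrier H. \<forall>h2\<in>carrier H. (h1, e) \<otimes>\<^bsub>G\<^esub> (h2, e) = (h1 \<otimes>\<^bsub>H\<^esub> h2, e)) \<and>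
       (\<one>\<^bsub>H\<^esub>, c) \<otimes>\<^bsub>G\<^esub> (\<one>\<^bsub>H\<^esub>, c) = (h0, e) \<and>
       (\<forall>h\<in>carrier H. (h, e) \<otimes>\<^bsub>G\<^esub> (\<one>\<^bsub>H\<^esub>, c) = (h, c)) \<and>
       (\<forall>h\<in>carrier H. (\<one>\<^bsub>H\<^esub>, c) \<otimes>\<^bsub>G\<^esub> (h, e) = (D h, c))"
    using mult_pair_product[OF H ec] auto_pairsD[OF H] assms(2) by (auto simp: Let_def)
qed

end
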